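(* Let $n\ge 1$ and $m\ge 2$ be integers, $\mathcal{X}$ a set of inputs, $\boldsymbol{I}:\mathcal{X}\to\mathbb{R}^n$ the (known) feature map, and let $W_S=(w_{ij})\in\mathbb{R}^{n\times m}$ and $\boldsymbol{b}_S=(b_{S,1},\dots,b_{S,m})\in\mathbb{R}^m$ be the weight matrix and bias vector of the last layer of the student network, whose output is $\mathcal{O}_\theta(\boldsymbol{x})=\mathrm{Softmax}(\boldsymbol{I}(\boldsymbol{x})^TW_S+\boldsymbol{b}_S)$. Let $j_0\in\{1,\dots,m\}$ and let $\boldsymbol{x}\in\mathcal{X}$ be any input. Let $z_{j_0}$ be the correct value of $\mathcal{O}_{\theta,j_0}(\boldsymbol{x})$, and let $\tilde z_{j_0}$ be the value of $\mathcal{O}_{\theta,j_0}(\boldsymbol{x})$ when a SNIFF on the bias $b_{S,j_0}$ is carried out. Then \[ b_{S,j_0}=\frac12\ln\left(\frac{\tilde z_{j_0}^{-1}-1}{z_{j_0}^{-1}-1}\right). \]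
   Context: All computations are in exact real arithmetic. The student network consists of a fixed known feature map $\boldsymbol{I}=(I_1,\dots,I_n):\mathcal{X}\to\mathbb{R}^n$ (the first $k-1$ layers of a public teacher network) followed by one fully connected layer with weights $W_S\in\mathbb{R}^{n\times m}$ and biases $\boldsymbol{b}_S\in\mathbb{R}^m$. For an input $\boldsymbol{x}$, put $y_j(\boldsymbol{x})=b_{S,j}+\sum_{i=1}^n I_i(\boldsymbol{x})w_{ij}$ for $j=1,\dots,m$. With softmax activation the $j$-th output is $\mathcal{O}_{\theta,j}(\boldsymbol{x})=\exp(y_j(\boldsymbol{x}))/\sum_{j'=1}^m\exp(y_{j'}(\boldsymbol{x}))$. SNIFF (sign bit flip fault) on the bias $b_{S,j_0}$: during the execution on $\boldsymbol{x}$, the value $b_{S,j_0}$ is replaced by $-b_{S,j_0}$ in the computation of $y_{j_0}$; everything else (in particular $y_j$ for $j\ne j_0$) is unchanged, and the activation is then applied to the resulting vector. *)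

theory Defs
  imports "HOL-Analysis.Analysis"
begin

definition softmax :: "real ^ 'm \<Rightarrow> real ^ 'm::finite" where
  "softmax y = (\<chi> j. exp (y $ j) / (\<Sum>j'\<in>UNIV. exp (y $ j')))"

text \<open>
  The type \<open>'n\<close> indexes the features and \<open>'m\<close> the outputs; the entry
  \<open>w\<^sub>i\<^sub>j\<close> of the \<open>n \<times> m\<close> weight matrix is \<open>W $ i $ j\<close>, so that
  \<open>(I x v* W + b) $ j = (\<Sum>i\<in>UNIV. W $ i $ j * I x $ i) + b $ j\<close>.
\<close>

definition last_layer ::
  "('x \<Rightarrow> real ^ 'n::finite) \<Rightarrow> real ^ 'm ^ 'n \<Rightarrow> real ^ 'm \<Rightarrow> 'x \<Rightarrow> real ^ 'm::finite" where
  "last_layer I W b x = I x v* W + b"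

definition student_output ::
  "('x \<Rightarrow> real ^ 'n::finite) \<Rightarrow> real ^ 'm ^ 'n \<Rightarrow> real ^ 'm \<Rightarrow> 'x \<Rightarrow> real ^ 'm::finite" where
  "student_output I W b x = softmax (last_layer I W b x)"

definition flip_sign :: "'m \<Rightarrow> real ^ 'm \<Rightarrow> real ^ 'm::finite" where
  "flip_sign j\<^sub>0 b = (\<chi> j. if j = j\<^sub>0 then - (b $ j) else b $ j)"

text \<open>
  A sign bit flip fault (SNIFF) on the bias with index \<open>j\<^sub>0\<close>: the bias enters the
  computation only through the pre-activation with the same index, so running the last
  layer on the flipped bias vector changes just that pre-activation, and the activation
  is applied to the faulty vector.
\<close>

definition sniff_output ::
  "('x \<Rightarrow> real ^ 'n::finite) \<Rightarrow> real ^ 'm ^ 'n \<Rightarrow> real ^ 'm \<Rightarrow> 'm \<Rightarrow> 'x \<Rightarrow> real ^ 'm::finite" where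
  "sniff_output I W b j\<^sub>0 x = softmax (last_layer I W (flip_sign j\<^sub>0 b) x)"

end

theory Submission
  imports Defs
begin

text \<open>
  With \<open>R\<close> the sum of the exponentials of the other outputs, \<open>1 / z - 1 = R / exp y\<close>, where
  \<open>y\<close> is the pre-activation at \<open>j\<^sub>0\<close>. The fault leaves \<open>R\<close> unchanged and lowers \<open>y\<close> by twice
  the bias, so \<open>R\<close> cancels in the quotient, which equals the exponential of twice the bias.
\<close>

lemma inverse_softmax_minus_1:
  "inverse (softmax y $ j) - 1 = (\<Sum>k\<in>UNIV - {j}. exp (y $ k)) / exp (y $ j)"
proof -
  have "(\<Sum>k\<in>UNIV. exp (y $ k)) = exp (y $ j) + (\<Sum>k\<in>UNIV - {j}. exp (y $ k))"
    by (simp add: sum.remove)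
  then show ?thesis
    by (simp add: softmax_def divide_simps)
qed

lemma last_layer_flip_sign:
  "last_layer I W (flip_sign j b) x $ k =
    (if k = j then last_layer I W b x $ k - 2 * b $ j else last_layer I W b x $ k)"
  by (simp add: last_layer_def flip_sign_def)

theorem theorem1:
  fixes X :: "'x set"
    and I :: "'x \<Rightarrow> real ^ 'n::finite"
    and W :: "real ^ 'm ^ 'n"
    and b :: "real ^ 'm::finite"
    and j\<^sub>0 :: 'm
    and x :: 'x
    and z z' :: real
  assumes "CARD('m) \<ge> 2"
    and "x \<in> X"
    and "z = student_output I W b x $ j\<^sub>0"
    and "z' = sniff_output I W b j\<^sub>0 x $ j\<^sub>0"
  shows "b $ j\<^sub>0 = 1 / 2 * ln ((inverse z' - 1) / (inverse z - 1))"
proof -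
  define y where "y = last_layer I W b x"
  define R where "R = (\<Sum>k\<in>UNIV - {j\<^sub>0}. exp (y $ k))"
  have "UNIV - {j\<^sub>0} \<noteq> {}"
  proof
    assume "UNIV - {j\<^sub>0} = {}"
    then have "(UNIV :: 'm set) = {j\<^sub>0}"
      by blast
    then have "CARD('m) = 1"
      by (metis card_1_singleton_iff One_nat_def)
    with assms(1) show False
      by simp
  qed
  then have "R > 0"
    unfolding R_def by (intro sum_pos) auto
  have "inverse z - 1 = R / exp (y $ j\<^sub>0)"
    by (simp add: assms(3) student_output_def inverse_softmax_minus_1 R_def y_def)
  moreover have "inverse z' - 1 = R / exp (y $ j\<^sub>0 - 2 * b $ j\<^sub>0)"
    by (simp add: assms(4) sniff_output_def inverse_softmax_minus_1 last_layer_flip_sign R_def y_def)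
  ultimately have "(inverse z' - 1) / (inverse z - 1) = exp (2 * b $ j\<^sub>0)"
    using \<open>R > 0\<close> by (simp add: exp_diff)
  then show ?thesis
    by simp
qed

end
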